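(* Let $s\in\mathbb{N}_0=\{0,1,2,\dots\}$. If $\nu\in\left[-\frac12,\frac12\right]$ and $n\in\{0,1\}$, or $\nu\in\left(0,\frac12\right]$ and $n=2$, then all the zeros of the hypergeometric polynomial $$x\mapsto {}_4F_4\left(-s,1,\frac{\nu}{2}+1,\frac{\nu}{2}+\frac32;\ \frac32,\nu+\frac32,\frac{\nu-n}{2}+1,\frac{\nu-n}{2}+\frac32;\ x\right)$$ are real and simple.
   Context: Here ${}_pF_q(a_1,\dots,a_p;b_1,\dots,b_q;x)=\sum_{m\ge0}\frac{(a_1)_m\cdots(a_p)_m}{(b_1)_m\cdots(b_q)_m}\frac{x^m}{m!}$ is the generalized hypergeometric series, with $(a)_m=a(a+1)\cdots(a+m-1)$, $(a)_0=1$. Since $-s$ is a nonpositive integer, the series terminates and is a polynomial in $x$ of degree at most $s$. "All zeros" refers to zeros in the complex plane. *)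

theory Defs
  imports
    "HOL-Analysis.Analysis"
    "HOL-Computational_Algebra.Computational_Algebra"
begin

text \<open>
  \<open>hypergeometric as bs\<close> is the function given by the library's formal hypergeometric series with
  scaling argument \<open>1\<close>; \<open>hypergeometric_series\<close> below spells out the coefficients. The value is
  meaningful where the series converges; it terminates as soon as some upper parameter is a
  nonpositive integer.
\<close>

definition hypergeometric :: "complex list \<Rightarrow> complex list \<Rightarrow> complex \<Rightarrow> complex" where
  "hypergeometric as bs = eval_fps (fps_hypergeo as bs 1)"

lemma foldl_times_eq_prod_list:
  "foldl (\<lambda>r a. r * f a) (c :: 'b :: comm_monoid_mult) as = c * prod_list (map f as)"
  by (induction as arbitrary: c) (simp_all add: mult.assoc)

lemma hypergeometric_series:
  "hypergeometric as bs x =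
     (\<Sum>m. (\<Prod>a\<leftarrow>as. pochhammer a m) / (\<Prod>b\<leftarrow>bs. pochhammer b m) * (x ^ m / fact m))"
  by (simp add: hypergeometric_def eval_fps_def foldl_times_eq_prod_list)

lemma hypergeometric_terminating:
  assumes "- of_nat s \<in> set as"
  shows "hypergeometric as bs x =
     (\<Sum>m\<le>s. (\<Prod>a\<leftarrow>as. pochhammer a m) / (\<Prod>b\<leftarrow>bs. pochhammer b m) * (x ^ m / fact m))"
  unfolding hypergeometric_series
proof (rule suminf_finite)
  fix m assume "m \<notin> {..s}"
  then have "pochhammer (- of_nat s :: complex) m = 0"
    by (simp add: pochhammer_of_nat_eq_0_iff)
  then have "(\<Prod>a\<leftarrow>as. pochhammer a m) = 0"
    using assms by (force simp: prod_list_zero_iff)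
  then show "(\<Prod>a\<leftarrow>as. pochhammer a m) / (\<Prod>b\<leftarrow>bs. pochhammer b m) * (x ^ m / fact m) = 0"
    by simp
qed simp

end

theory Submission
  imports Defs
begin

text \<open>
  For \<open>n = 0\<close> the polynomial is \<open>\<^sub>2F\<^sub>2(-s, 1; 3/2, b; x)\<close> with \<open>b = \<nu> + 3/2\<close> in \<open>[1, 2]\<close>, which is the
  mean of \<open>L (x t)\<close>, \<open>L = \<^sub>1F\<^sub>1(-s; 3/2; x)\<close>, over the beta distribution \<open>(b - 1) (1 - t) powr (b - 2) dt\<close>.
  Now \<open>L\<close> is, up to a negative factor, the derivative of \<open>Q = \<^sub>1F\<^sub>1(-s-1; 1/2; x)\<close>, and integration by
  parts turns the mean, up to a negative factor, into
  \<open>(b - 1) (Q x - 1) + (2 - b) E [(Q x - Q (x t)) / (1 - t)]\<close>. By Sonin's argument every critical value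
  of \<open>Q\<close> dominates \<open>\<bar>Q\<bar>\<close> to its left, so at the zeros of \<open>L\<close> this expression has the sign of \<open>Q\<close>, which
  alternates. Together with the sign at infinity this gives \<open>s\<close> distinct positive zeros.
  Passing to \<open>n = 1\<close> and \<open>n = 2\<close> amounts to applying operators \<open>1 + (x / a) d/dx\<close> with \<open>a > 0\<close>, which
  preserve this property by Rolle's theorem for \<open>x powr a * p x\<close>.
\<close>

section \<open>Polynomials with simple positive zeros\<close>

text \<open>Factors \<open>z k - x\<close> and \<open>c > 0\<close> fix the sign pattern: positive
  to the left of all zeros, then alternating.\<close>

definition simple_positive_zeros :: "nat \<Rightarrow> (nat \<Rightarrow> real) \<Rightarrow> real poly \<Rightarrow> bool" where
  "simple_positive_zeros n z p \<longleftrightarrow>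
     strict_mono_on {..<n} z \<and> (\<forall>k<n. 0 < z k) \<and> (\<exists>c>0. p = smult c (\<Prod>k<n. [:z k, -1:]))"

lemma degree_prod_linear: "degree (\<Prod>k<n. [:z k, -1:]) = n"
  for z :: "nat \<Rightarrow> 'a::idom"
  by (subst degree_prod_eq_sum_degree) auto

lemma coeff_prod_linear: "coeff (\<Prod>k<n. [:z k, -1:]) n = (-1) ^ n"
  for z :: "nat \<Rightarrow> 'a::idom"
  using lead_coeff_prod[of "\<lambda>k. [:z k, -1:]" "{..<n}"] by (simp add: degree_prod_linear)

lemma simple_positive_zerosD:
  assumes "simple_positive_zeros n z p"
  shows "strict_mono_on {..<n} z" "\<And>k. k < n \<Longrightarrow> 0 < z k" "\<And>k. k < n \<Longrightarrow> poly p (z k) = 0"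
    "degree p = n" "(-1) ^ n * coeff p n > 0" "poly p 0 > 0"
    "\<And>x. (\<And>k. k < n \<Longrightarrow> x < z k) \<Longrightarrow> poly p x > 0"
proof -
  obtain c where z: "strict_mono_on {..<n} z" "\<And>k. k < n \<Longrightarrow> 0 < z k"
    and c: "c > 0" "p = smult c (\<Prod>k<n. [:z k, -1:])"
    using assms unfolding simple_positive_zeros_def by auto
  show "strict_mono_on {..<n} z" "\<And>k. k < n \<Longrightarrow> 0 < z k" by fact+
  show "\<And>k. k < n \<Longrightarrow> poly p (z k) = 0" by (auto simp: c poly_prod)
  show "degree p = n" using c by (simp add: degree_prod_linear)
  show "(-1) ^ n * coeff p n > 0" using c
    by (simp add: coeff_prod_linear mult.left_commute flip: power_add mult_2)
  show *: "poly p x > 0" if "\<And>k. k < n \<Longrightarrow> x < z k" for x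
    using c that by (auto simp: poly_prod intro!: mult_pos_pos prod_pos)
  show "poly p 0 > 0" using z by (intro *) auto
qed

text \<open>The sign at infinity acts as one more sample, so the \<open>n\<close> alternating
  samples yield \<open>n\<close> zeros by the intermediate value theorem, and the degree bound
  excludes others.\<close>

lemma simple_positive_zerosI:
  fixes p :: "real poly"
  assumes deg: "degree p \<le> n" and coeff: "(-1) ^ n * coeff p n > 0"
    and y: "strict_mono_on {..<n} y" "\<And>k. k < n \<Longrightarrow> 0 \<le> y k"
    and sign: "\<And>k. k < n \<Longrightarrow> (-1) ^ k * poly p (y k) > 0"
  shows "\<exists>z. simple_positive_zeros n z p"
proof -
  define q where "q = smult ((-1) ^ n) p"
  have "coeff p n \<noteq> 0" using coeff by auto
  with deg have dp: "degree p = n" by (simp add: le_antisym le_degree)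
  then have "lead_coeff q > 0" using coeff by (simp add: q_def)
  then obtain X where X: "\<And>x. x \<ge> X \<Longrightarrow> poly q x \<ge> lead_coeff q"
    using poly_pinfty_gt_lc by blast
  \<comment> \<open>Beyond \<open>X\<close> the leading coefficient decides the sign; the sum has
    nonnegative terms, so \<open>Y\<close> exceeds every sample point.\<close>
  define Y where "Y = max X (1 + (\<Sum>k<n. y k))"
  have Ysign: "(-1) ^ n * poly p Y > 0"
    using X[of Y] \<open>lead_coeff q > 0\<close> by (simp add: Y_def q_def)
  have Y: "y k < Y" if "k < n" for k
  proof -
    have "y k \<le> (\<Sum>k<n. y k)" by (rule member_le_sum) (use that y(2) in auto)
    then show ?thesis by (simp add: Y_def)
  qed
  define u where "u k = (if k < n then y k else Y)" for k
  have u: "u k < u (Suc k)" if "k < n" for k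
    using that Y y(1) by (auto simp: u_def strict_mono_on_def)
  have usign: "(-1) ^ k * poly p (u k) > 0" if "k \<le> n" for k
    using that Ysign sign by (auto simp: u_def le_less)
  have "\<exists>z. u k < z \<and> z < u (Suc k) \<and> poly p z = 0" if "k < n" for k
  proof (rule poly_IVT[OF u[OF that]])
    show "poly p (u k) * poly p (u (Suc k)) < 0"
      using usign[of k] usign[of "Suc k"] that by (cases "even k") (auto simp: mult_less_0_iff)
  qed
  then obtain z where z: "\<And>k. k < n \<Longrightarrow> u k < z k" "\<And>k. k < n \<Longrightarrow> z k < u (Suc k)"
      "\<And>k. k < n \<Longrightarrow> poly p (z k) = 0"
    by metis
  have step: "u i \<le> u j" if "i \<le> j" "j \<le> n" for i j
    using that
  proof (induction j rule: dec_induct)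
    case (step j) then show ?case using u[of j] by auto
  qed auto
  have mono: "z i < z j" if "i < j" "j < n" for i j
  proof -
    have "z i < u (Suc i)" using z that by auto
    also have "\<dots> \<le> u j" using that by (intro step) auto
    also have "\<dots> < z j" using z that by auto
    finally show ?thesis .
  qed
  have sm: "strict_mono_on {..<n} z" using mono by (auto simp: strict_mono_on_def)
  have pos: "0 < z k" if "k < n" for k
    using z(1)[OF that] y(2)[OF that] that by (simp add: u_def)
  \<comment> \<open>Both sides have degree at most \<open>n\<close>, agree at \<open>n\<close>
    points and share the coefficient of index \<open>n\<close>.\<close>
  have "p = smult ((-1) ^ n * coeff p n) (\<Prod>k<n. [:z k, -1:])"
  proof (rule poly_eqI_degree_lead_coeff)
    show "card (z ` {..<n}) \<ge> n"
      using sm by (simp add: card_image strict_mono_on_imp_inj_on)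
    show "coeff p n = coeff (smult ((-1) ^ n * coeff p n) (\<Prod>k<n. [:z k, -1:])) n"
      by (simp add: coeff_prod_linear mult.left_commute[of _ "coeff p n"] flip: power_add mult_2)
    show "degree (smult ((-1) ^ n * coeff p n) (\<Prod>k<n. [:z k, -1:])) \<le> n"
      using degree_smult_le by (metis degree_prod_linear)
    fix x assume "x \<in> z ` {..<n}"
    then obtain k where k: "k < n" "x = z k" by auto
    then have "(\<Prod>k<n. poly [:z k, -1:] x) = 0"
      by (intro prod_zero) auto
    then show "poly p x = poly (smult ((-1) ^ n * coeff p n) (\<Prod>k<n. [:z k, -1:])) x"
      using z(3) k by (simp add: poly_prod)
  qed (rule deg)
  with sm pos coeff show ?thesis unfolding simple_positive_zeros_def by blast
qed

section \<open>Differential operators preserving simple positive zeros\<close>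

lemma poly_pderiv_prod_linear:
  fixes z :: "nat \<Rightarrow> 'a::idom"
  assumes "k < n"
  shows "poly (pderiv (\<Prod>i<n. [:z i, -1:])) (z k) = - (\<Prod>i\<in>{..<n}-{k}. z i - z k)"
proof -
  have "poly (pderiv (\<Prod>i<n. [:z i, -1:])) (z k)
      = (\<Sum>j<n. - (\<Prod>i\<in>{..<n}-{j}. z i - z k))"
    by (simp add: pderiv_prod pderiv_pCons poly_sum poly_prod)
  also have "\<dots> = (\<Sum>j\<in>{k}. - (\<Prod>i\<in>{..<n}-{j}. z i - z k))"
    by (rule sum.mono_neutral_right) (use assms in \<open>auto intro!: prod_zero\<close>)
  finally show ?thesis by simp
qed

text \<open>Only the term differentiating the factor of \<open>z k\<close> survives; the derivative
  \<open>-1\<close> and the \<open>k\<close> negative factors \<open>z i - z k\<close> with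
  \<open>i < k\<close> give the sign.\<close>

lemma simple_positive_zeros_pderiv_sign:
  assumes "simple_positive_zeros n z p" "k < n"
  shows "(-1) ^ Suc k * poly (pderiv p) (z k) > 0"
proof -
  obtain c where z: "strict_mono_on {..<n} z" 
    and c: "c > 0" "p = smult c (\<Prod>k<n. [:z k, -1:])"
    using assms unfolding simple_positive_zeros_def by auto
  have split: "{..<n} - {k} = {..<k} \<union> {k<..<n}" using assms by auto
  have "(\<Prod>i\<in>{..<n}-{k}. z i - z k) = (\<Prod>i<k. z i - z k) * (\<Prod>i\<in>{k<..<n}. z i - z k)"
    unfolding split by (rule prod.union_disjoint) auto
  also have "(\<Prod>i<k. z i - z k) = (\<Prod>i<k. (-1) * (z k - z i))" by simp
  also have "\<dots> = (-1) ^ k * (\<Prod>i<k. z k - z i)" by (subst prod.distrib) simp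
  finally have "(-1) ^ Suc k * poly (pderiv p) (z k)
      = c * ((\<Prod>i<k. z k - z i) * (\<Prod>i\<in>{k<..<n}. z i - z k))"
    using assms by (cases "even k") (simp_all add: c pderiv_smult poly_pderiv_prod_linear)
  also have "\<dots> > 0"
    using c z assms(2) by (intro mult_pos_pos prod_pos) (auto simp: strict_mono_on_def)
  finally show ?thesis .
qed

lemma strict_mono_on_case_nat:
  fixes z :: "nat \<Rightarrow> real"
  assumes "strict_mono_on {..<n} z" "\<And>k. k < n \<Longrightarrow> 0 < z k"
  shows "strict_mono_on {..<Suc n} (case_nat 0 z)"
  using assms unfolding strict_mono_on_def by (auto split: nat.split)

text \<open>At a zero of \<open>p\<close> the operator reduces to \<open>x * p'\<close>, whose sign
  is known, and at \<open>0\<close> to \<open>a * p 0 > 0\<close>.\<close>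

lemma simple_positive_zeros_euler:
  assumes "simple_positive_zeros n z p" "a > 0"
  shows "\<exists>w. simple_positive_zeros n w (smult a p + [:0, 1:] * pderiv p)"
proof -
  note z = simple_positive_zerosD[OF assms(1)]
  let ?q = "smult a p + [:0, 1:] * pderiv p"
  have coeff: "coeff ?q m = (a + m) * coeff p m" for m
    by (cases m) (simp_all add: coeff_pderiv algebra_simps)
  \<comment> \<open>The samples are \<open>0\<close>, \<open>z 0\<close>, ...,
    \<open>z (n - 2)\<close>; the largest zero is left out, since the leading coefficient supplies
    the last sign.\<close>
  have sm: "strict_mono_on {..<n} (case_nat 0 z)"
    using strict_mono_on_case_nat[OF z(1,2)] by (auto simp: strict_mono_on_def)
  show ?thesis
  proof (rule simple_positive_zerosI[OF _ _ sm])
    show "degree ?q \<le> n" using z(4) by (intro degree_le) (auto simp only: coeff coeff_eq_0 mult_zero_right)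
    show "(-1) ^ n * coeff ?q n > 0" 
      unfolding coeff using z(5) assms(2) by (simp add: mult.left_commute)
    fix k assume k: "k < n"
    show "0 \<le> (case k of 0 \<Rightarrow> 0 | Suc i \<Rightarrow> z i)" using k z(2) by (auto split: nat.split intro: less_imp_le)
    show "(-1) ^ k * poly ?q (case k of 0 \<Rightarrow> 0 | Suc i \<Rightarrow> z i) > 0"
    proof (cases k)
      case 0 then show ?thesis using z(6) assms(2) by simp
    next
      case (Suc i)
      then show ?thesis using simple_positive_zeros_pderiv_sign[OF assms(1), of i] z(2)[of i] z(3)[of i] k
        by (simp add: mult.left_commute mult_less_0_iff)
    qed
  qed
qed

text \<open>The degree grows by one, so here \<open>0\<close> and all \<open>n\<close> zeros of
  \<open>p\<close> serve as samples.\<close>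

lemma simple_positive_zeros_raise:
  assumes "simple_positive_zeros n z p" "c > 0"
  shows "\<exists>w. simple_positive_zeros (Suc n) w ([:c, -1:] * p + [:0, 1:] * pderiv p)"
proof -
  note z = simple_positive_zerosD[OF assms(1)]
  let ?q = "[:c, -1:] * p + [:0, 1:] * pderiv p"
  have coeff: "coeff ?q (Suc m) = (c + Suc m) * coeff p (Suc m) - coeff p m" for m
    by (simp add: coeff_pderiv algebra_simps)
  have "coeff ?q m = 0" if "m > Suc n" for m
    using that z(4) by (cases m) (simp, simp only: coeff, simp add: coeff_eq_0)
  then have "degree ?q \<le> Suc n" by (intro degree_le) auto
  then show ?thesis
  proof (rule simple_positive_zerosI[OF _ _ strict_mono_on_case_nat[OF z(1,2)]])
    show "(-1) ^ Suc n * coeff ?q (Suc n) > 0" 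
      unfolding coeff using z(4,5) by (simp add: coeff_eq_0)
    fix k assume k: "k < Suc n"
    show "0 \<le> (case k of 0 \<Rightarrow> 0 | Suc i \<Rightarrow> z i)" using k z(2) by (auto split: nat.split intro: less_imp_le)
    show "(-1) ^ k * poly ?q (case k of 0 \<Rightarrow> 0 | Suc i \<Rightarrow> z i) > 0"
    proof (cases k)
      case 0 then show ?thesis using z(6) assms(2) by simp
    next
      case (Suc i)
      then show ?thesis using simple_positive_zeros_pderiv_sign[OF assms(1), of i] z(2)[of i] z(3)[of i] k
        by (simp add: mult.left_commute mult_less_0_iff)
    qed
  qed auto
qed

section \<open>Jensen and Laguerre polynomials\<close>

text \<open>Jensen polynomials are taken at \<open>-x\<close>, which makes the zeros positive.\<close>

definition jensen_poly :: "nat \<Rightarrow> (nat \<Rightarrow> real) \<Rightarrow> real poly" where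
  "jensen_poly n \<gamma> = (\<Sum>m\<le>n. monom ((-1) ^ m * real (n choose m) * \<gamma> m) m)"

lemma coeff_jensen_poly: "coeff (jensen_poly n \<gamma>) m = (-1) ^ m * real (n choose m) * \<gamma> m"
  unfolding jensen_poly_def by (auto simp: coeff_sum)

lemma degree_jensen_poly_le: "degree (jensen_poly n \<gamma>) \<le> n"
  by (rule degree_le) (simp add: coeff_jensen_poly)

text \<open>This is \<open>\<^sub>1F\<^sub>1(-n; c; x)\<close>, the generalized Laguerre polynomial of parameter \<open>c - 1\<close> up to a
  constant factor.\<close>

abbreviation laguerre_gen :: "nat \<Rightarrow> real \<Rightarrow> real poly" where
  "laguerre_gen n c \<equiv> jensen_poly n (\<lambda>m. 1 / pochhammer c m)"

text \<open>The right side is the operator of \<open>simple_positive_zeros_raise\<close>, so the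
  zeros can be located without orthogonality.\<close>

lemma laguerre_gen_Suc:
  assumes "c > 0"
  shows "smult c (laguerre_gen (Suc n) c)
    = [:c, -1:] * laguerre_gen n (c + 1) + [:0, 1:] * pderiv (laguerre_gen n (c + 1))"
proof (rule poly_eqI)
  fix m
  show "coeff (smult c (laguerre_gen (Suc n) c)) m
    = coeff ([:c, -1:] * laguerre_gen n (c + 1) + [:0, 1:] * pderiv (laguerre_gen n (c + 1))) m"
  proof (cases m)
    case 0 then show ?thesis by (simp add: coeff_jensen_poly)
  next
    case (Suc k)
    have "pochhammer (c + 1) k > 0" using assms by (intro pochhammer_pos) auto
    moreover have "c + 1 + real k > 0" using assms by simp
    ultimately show ?thesis using assms unfolding Suc
      by (simp add: coeff_jensen_poly coeff_pderiv pochhammer_Suc[of "c + 1"] pochhammer_rec[of c] divide_simps)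
         (simp add: algebra_simps)
  qed
qed

lemma pderiv_laguerre_gen:
  assumes "c > 0"
  shows "pderiv (laguerre_gen (Suc n) c) = smult (- real (Suc n) / c) (laguerre_gen n (c + 1))"
proof (rule poly_eqI)
  fix m
  have "pochhammer (c + 1) m > 0" using assms by (intro pochhammer_pos) auto
  moreover have "real (Suc m) * real (Suc n choose Suc m) = real (Suc n) * real (n choose m)"
    by (metis Suc_times_binomial of_nat_mult)
  ultimately show "coeff (pderiv (laguerre_gen (Suc n) c)) m
      = coeff (smult (- real (Suc n) / c) (laguerre_gen n (c + 1))) m"
    using assms by (simp add: coeff_jensen_poly coeff_pderiv pochhammer_rec[of c] divide_simps del: binomial_Suc_Suc of_nat_Suc)
qed

lemma simple_positive_zeros_smult:
  assumes "simple_positive_zeros n z p" "a > 0"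
  shows "simple_positive_zeros n z (smult a p)"
  using assms unfolding simple_positive_zeros_def by (metis mult_pos_pos smult_smult)

text \<open>Raising the degree lowers the parameter from \<open>c + 1\<close> to \<open>c\<close>,
  hence the induction with \<open>c\<close> arbitrary.\<close>

lemma simple_positive_zeros_laguerre_gen:
  "c > 0 \<Longrightarrow> \<exists>z. simple_positive_zeros n z (laguerre_gen n c)"
proof (induction n arbitrary: c)
  case 0
  show ?case by (auto simp: simple_positive_zeros_def jensen_poly_def intro!: exI[of _ 1])
next
  case (Suc n)
  obtain z where "simple_positive_zeros n z (laguerre_gen n (c + 1))"
    using Suc.IH[of "c + 1"] Suc.prems by auto
  from simple_positive_zeros_raise[OF this Suc.prems] laguerre_gen_Suc[OF Suc.prems, of n]
  obtain w where "simple_positive_zeros (Suc n) w (smult c (laguerre_gen (Suc n) c))" by auto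
  from simple_positive_zeros_smult[OF this, of "1 / c"] Suc.prems show ?case by auto
qed

section \<open>Beta means of polynomials\<close>

lemma poly_eq_sum_atMost:
  "degree p \<le> n \<Longrightarrow> poly p x = (\<Sum>m\<le>n. coeff p m * x ^ m)"
  for x :: "'a::comm_semiring_1"
  unfolding poly_altdef by (rule sum.mono_neutral_left) (auto simp: coeff_eq_0)

text \<open>The moments of the beta distribution with parameters \<open>1\<close> and \<open>b - 1\<close>; at \<open>b = 1\<close> it
  degenerates to the point mass at \<open>1\<close>.\<close>

definition beta_moment :: "real \<Rightarrow> nat \<Rightarrow> real" where
  "beta_moment b m = fact m / pochhammer b m"

lemma has_integral_beta_moment:
  assumes "b > 1"
  shows "((\<lambda>t. (b - 1) * (1 - t) powr (b - 2) * t ^ m) has_integral beta_moment b m) {0..1}"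
proof -
  have "pochhammer (b - 1) (Suc m) = Gamma (b + real m) / Gamma (b - 1)"
    using assms by (subst pochhammer_Gamma) (auto elim!: nonpos_Ints_cases)
  moreover have pos: "Gamma (b - 1) > 0" using assms by (intro Gamma_real_pos) auto
  ultimately have Gamma: "Gamma (b + real m) = (b - 1) * pochhammer b m * Gamma (b - 1)"
    using pos by (simp add: pochhammer_rec field_simps)
  have arg: "real (Suc m) + (b - 1) = b + real m" by simp
  have fact: "Gamma (real (Suc m)) = fact m" using Gamma_fact[of m, where 'a = real] by (simp add: add.commute)
  have eq: "(b - 1) * Beta (real (Suc m)) (b - 1) = beta_moment b m"
    unfolding Beta_def beta_moment_def arg fact Gamma using assms less_imp_neq[OF pos] by simp
  have "((\<lambda>t. t powr (real (Suc m) - 1) * (1 - t) powr (b - 1 - 1))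
      has_integral Beta (real (Suc m)) (b - 1)) {0..1}"
    by (rule has_integral_Beta_real) (use assms in auto)
  from has_integral_mult_right[OF this, of "b - 1"]
  have "((\<lambda>t. (b - 1) * (t powr (real (Suc m) - 1) * (1 - t) powr (b - 1 - 1)))
      has_integral beta_moment b m) {0..1}" unfolding eq .
  then show ?thesis
    \<comment> \<open>The point \<open>0\<close> is exempted because \<open>0 powr 0 = 0\<close>
      while \<open>0 ^ 0 = 1\<close>.\<close>
    by (rule has_integral_spike_finite[of "{0}", rotated -1]) (auto simp: powr_realpow)
qed

text \<open>For \<open>b > 1\<close> this is the mean of \<open>p (x * t)\<close> over the beta
  distribution; working on coefficients keeps it a polynomial.\<close>

definition beta_mean :: "real \<Rightarrow> real poly \<Rightarrow> real poly" where
  "beta_mean b p = (\<Sum>m\<le>degree p. monom (beta_moment b m * coeff p m) m)"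

lemma coeff_beta_mean: "coeff (beta_mean b p) m = beta_moment b m * coeff p m"
  unfolding beta_mean_def by (auto simp: coeff_sum coeff_eq_0)

lemma beta_mean_smult: "beta_mean b (smult a p) = smult a (beta_mean b p)"
  by (rule poly_eqI) (simp add: coeff_beta_mean)

text \<open>The recurrence
  \<open>(b + m) * beta_moment b (m + 1) = (m + 1) * beta_moment b m\<close> makes the left side
  grow by \<open>(2 - b) * beta_moment b (m + 1)\<close> at each step.\<close>

lemma sum_beta_moment:
  assumes "b > 0"
  shows "real (Suc m) * beta_moment b m = (b - 1) + (2 - b) * (\<Sum>j<Suc m. beta_moment b j)"
proof (induction m)
  case 0 then show ?case by (simp add: beta_moment_def)
next
  case (Suc m)
  have "(b + real m) * beta_moment b (Suc m) = real (Suc m) * beta_moment b m"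
    using assms by (simp add: beta_moment_def pochhammer_Suc)
  with Suc show ?case by (simp add: algebra_simps)
qed

text \<open>Integration by parts for the weight \<open>(b - 1) (1 - t) powr (b - 2)\<close>, done on the moments so that
  the singularity at \<open>1\<close> never appears.\<close>

lemma beta_mean_pderiv:
  assumes "b > 0"
  shows "x * poly (beta_mean b (pderiv q)) x = (b - 1) * (poly q x - poly q 0)
    + (2 - b) * (\<Sum>m\<le>degree q. coeff q m * x ^ m * (\<Sum>j<m. beta_moment b j))"
proof -
  let ?p = "pCons 0 (beta_mean b (pderiv q))"
  define B where "B m = (\<Sum>j<m. beta_moment b j)" for m
  have coeff: "coeff ?p m = coeff q m * ((b - 1) * of_bool (m > 0) + (2 - b) * B m)" for m
  proof (cases m)
    case (Suc k)
    have "coeff ?p m = coeff q (Suc k) * (real (Suc k) * beta_moment b k)"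
      by (simp add: Suc coeff_beta_mean coeff_pderiv)
    then show ?thesis unfolding sum_beta_moment[OF assms] by (simp add: Suc B_def)
  qed (simp add: B_def)
  have "x * poly (beta_mean b (pderiv q)) x = poly ?p x" by simp
  also have "\<dots> = (\<Sum>m\<le>degree q. coeff ?p m * x ^ m)"
    by (rule poly_eq_sum_atMost, rule degree_le) (simp add: coeff coeff_eq_0)
  also have "\<dots> = (b - 1) * (\<Sum>m\<le>degree q. coeff q m * x ^ m * of_bool (m > 0))
     + (2 - b) * (\<Sum>m\<le>degree q. coeff q m * x ^ m * B m)"
    unfolding coeff by (simp add: sum_distrib_left sum.distrib[symmetric] algebra_simps)
  also have "(\<Sum>m\<le>degree q. coeff q m * x ^ m * of_bool (m > 0)) = poly q x - poly q 0"
    unfolding poly_altdef by (simp add: sum.atMost_shift)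
  finally show ?thesis unfolding B_def .
qed

text \<open>A maximum principle: up to a power of \<open>x\<close>, \<open>beta_mean b \<circ> pderiv\<close> is a fractional derivative
  of order \<open>2 - b\<close>.\<close>

lemma beta_mean_pderiv_pos:
  assumes b: "1 < b" "b \<le> 2" and x: "x > 0"
    and max: "\<And>u. 0 \<le> u \<Longrightarrow> u \<le> x \<Longrightarrow> poly q u \<le> poly q x" and "poly q 0 < poly q x"
  shows "poly (beta_mean b (pderiv q)) x > 0"
proof -
  let ?J = "\<Sum>m\<le>degree q. coeff q m * x ^ m * (\<Sum>j<m. beta_moment b j)"
  have "((\<lambda>t. \<Sum>m\<le>degree q. coeff q m * x ^ m * (\<Sum>j<m. (b - 1) * (1 - t) powr (b - 2) * t ^ j))
     has_integral ?J) {0..1}"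
    by (intro has_integral_sum has_integral_mult_right has_integral_beta_moment b) auto
  then have "?J \<ge> 0"
  proof (rule has_integral_nonneg)
    fix t :: real assume t: "t \<in> {0..1}"
    \<comment> \<open>The difference quotient \<open>(q x - q (x * t)) / (1 - t)\<close>, written
      without division.\<close>
    define g where "g = (\<Sum>m\<le>degree q. coeff q m * x ^ m * (\<Sum>j<m. t ^ j))"
    have "(1 - t) * g = (\<Sum>m\<le>degree q. coeff q m * x ^ m * ((1 - t) * (\<Sum>j<m. t ^ j)))"
      unfolding g_def by (simp add: sum_distrib_left mult_ac)
    also have "\<dots> = poly q x - poly q (x * t)"
      unfolding one_diff_power_eq[symmetric]
      by (simp add: poly_altdef sum_subtractf power_mult_distrib algebra_simps)
    also have "\<dots> \<ge> 0" using max[of "x * t"] t x by (simp add: mult_left_le)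
    finally have "g \<ge> 0 \<or> t = 1" using t by (auto simp: zero_le_mult_iff)
    moreover have "(\<Sum>m\<le>degree q. coeff q m * x ^ m * (\<Sum>j<m. (b - 1) * (1 - t) powr (b - 2) * t ^ j))
       = (b - 1) * (1 - t) powr (b - 2) * g"
      unfolding g_def by (simp add: sum_distrib_left mult_ac)
    ultimately show "0 \<le> (\<Sum>m\<le>degree q. coeff q m * x ^ m * (\<Sum>j<m. (b - 1) * (1 - t) powr (b - 2) * t ^ j))"
      using b t by auto
  qed
  \<comment> \<open>Strictness comes from the boundary term
    \<open>(b - 1) * (q x - q 0)\<close>.\<close>
  then have "x * poly (beta_mean b (pderiv q)) x > 0"
    using assms beta_mean_pderiv[of b x q] by (simp add: add_pos_nonneg)
  then show ?thesis using x by (simp add: zero_less_mult_iff)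
qed

section \<open>Sonin's argument and the case \<open>n = 0\<close>\<close>

text \<open>Since \<open>Q'\<close> is a multiple of \<open>L\<close>, the zeros of \<open>L\<close> are the extrema of \<open>Q\<close> (up to scaling
  and \<open>x = y\<^sup>2\<close>, \<open>Q\<close> is an even Hermite polynomial). Sonin's function
  \<open>Q\<^sup>2 + x Q'\<^sup>2 / (s + 1)\<close> is increasing and equals \<open>Q\<^sup>2\<close> there.\<close>

lemma laguerre_gen_extrema:
  fixes s :: nat
  defines "L \<equiv> laguerre_gen s (3/2)" and "Q \<equiv> laguerre_gen (Suc s) (1/2)"
  assumes z: "simple_positive_zeros s z L" and k: "k < s"
  shows "\<And>u. 0 \<le> u \<Longrightarrow> u \<le> z k \<Longrightarrow> \<bar>poly Q u\<bar> \<le> \<bar>poly Q (z k)\<bar>"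
    and "1 < \<bar>poly Q (z k)\<bar>"
    and "(-1) ^ Suc k * poly Q (z k) > 0"
proof -
  define N where "N = real (Suc s)"
  have N: "N > 0" by (simp add: N_def)
  have "smult (1/2) Q = [:1/2, -1:] * L + [:0, 1:] * pderiv L"
    using laguerre_gen_Suc[of "1/2" s] by (simp add: Q_def L_def)
  then have "poly (smult (1/2) Q) x = poly ([:1/2, -1:] * L + [:0, 1:] * pderiv L) x" for x
    by simp
  then have Q: "poly Q x = (1 - 2 * x) * poly L x + 2 * x * poly (pderiv L) x" for x
    by (simp add: field_simps)
  have Q': "pderiv Q = smult (- 2 * N) L"
    using pderiv_laguerre_gen[of "1/2" s] by (simp add: Q_def L_def N_def mult.commute del: of_nat_Suc)
  \<comment> \<open>As \<open>Q' = - 2 * N * L\<close>, the second term is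
    \<open>x * Q'^2 / N\<close>.\<close>
  define S where "S x = (poly Q x)\<^sup>2 + 4 * N * x * (poly L x)\<^sup>2" for x
  have S': "(S has_real_derivative 8 * N * x * (poly L x)\<^sup>2) (at x)" for x
    unfolding S_def
    by (rule derivative_eq_intros poly_DERIV refl | simp)+ (simp add: Q' Q[of x] algebra_simps power2_eq_square)
  have mono: "S u \<le> S v" if "0 \<le> u" "u \<le> v" for u v
  proof (rule DERIV_nonneg_imp_nondecreasing[OF that(2)])
    fix x assume "u \<le> x" "x \<le> v"
    then show "\<exists>y. (S has_real_derivative y) (at x) \<and> 0 \<le> y"
      using S'[of x] that N by (intro exI[of _ "8 * N * x * (poly L x)\<^sup>2"]) auto
  qed
  note zD = simple_positive_zerosD[OF z]
  have S_zero: "S (z k) = (poly Q (z k))\<^sup>2" using zD(3)[OF k] by (simp add: S_def)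
  show "\<bar>poly Q u\<bar> \<le> \<bar>poly Q (z k)\<bar>" if "0 \<le> u" "u \<le> z k" for u
  proof -
    have "(poly Q u)\<^sup>2 \<le> S u" using that N by (simp add: S_def)
    also have "\<dots> \<le> (poly Q (z k))\<^sup>2" using mono[OF that] S_zero by simp
    finally show ?thesis by (simp add: abs_le_square_iff)
  qed
  have z0: "0 < z 0" "z 0 \<le> z k"
    using zD(2)[of 0] strict_mono_on_leD[OF zD(1), of 0 k] k by auto
  \<comment> \<open>Strict growth, because \<open>L\<close> is positive to the left of its first
    zero.\<close>
  have "S 0 < S (z 0)"
  proof -
    obtain x where x: "0 < x" "x < z 0" "S (z 0) - S 0 = (z 0 - 0) * (8 * N * x * (poly L x)\<^sup>2)"
      using MVT2[OF z0(1), of S "\<lambda>x. 8 * N * x * (poly L x)\<^sup>2"] S' by auto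
    have "x < z j" if "j < s" for j
      using x(2) zD(1) that k by (cases j) (auto simp: strict_mono_on_def intro: less_trans)
    then have "poly L x > 0" by (rule zD(7))
    then have "(z 0 - 0) * (8 * N * x * (poly L x)\<^sup>2) > 0" using x z0 N by simp
    with x(3) show ?thesis by linarith
  qed
  also have "\<dots> \<le> S (z k)" using z0 by (intro mono) auto
  also have "S 0 = 1" by (simp add: S_def Q_def poly_0_coeff_0 coeff_jensen_poly)
  finally have "1\<^sup>2 < (poly Q (z k))\<^sup>2" using S_zero by simp
  then show "1 < \<bar>poly Q (z k)\<bar>" 
    using power2_less_imp_less[of 1 "\<bar>poly Q (z k)\<bar>"] by simp
  show "(-1) ^ Suc k * poly Q (z k) > 0"
  proof -
    have "(-1) ^ Suc k * poly Q (z k) = 2 * z k * ((-1) ^ Suc k * poly (pderiv L) (z k))"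
      using zD(3)[OF k] by (simp add: Q)
    also have "\<dots> > 0"
      using zD(2)[OF k] by (intro mult_pos_pos[OF _ simple_positive_zeros_pderiv_sign[OF z k]]) simp
    finally show ?thesis .
  qed
qed

lemma simple_positive_zeros_beta_laguerre:
  assumes b: "1 \<le> b" "b \<le> 2"
  shows "\<exists>z. simple_positive_zeros s z (jensen_poly s (\<lambda>m. fact m / (pochhammer (3/2) m * pochhammer b m)))"
proof -
  let ?L = "laguerre_gen s (3/2)" and ?Q = "laguerre_gen (Suc s) (1/2)"
  let ?p = "jensen_poly s (\<lambda>m. fact m / (pochhammer (3/2) m * pochhammer b m))"
  obtain z where z: "simple_positive_zeros s z ?L"
    using simple_positive_zeros_laguerre_gen[of "3/2" s] by auto
  note zD = simple_positive_zerosD[OF z]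
  have p: "?p = beta_mean b ?L"
    by (rule poly_eqI) (simp add: coeff_beta_mean coeff_jensen_poly beta_moment_def mult_ac)
  show ?thesis
  proof (cases "b = 1")
    case True
    \<comment> \<open>At \<open>b = 1\<close>, \<open>pochhammer b m\<close> cancels
      \<open>fact m\<close>.\<close>
    then have "?p = ?L" by (intro poly_eqI) (simp add: coeff_jensen_poly flip: pochhammer_fact)
    with z show ?thesis by auto
  next
    case False
    with b have b: "1 < b" "b \<le> 2" by auto
    show ?thesis
    proof (rule simple_positive_zerosI[OF degree_jensen_poly_le _ zD(1)])
      have "pochhammer (3/2::real) s > 0" "pochhammer b s > 0"
        using b by (auto intro!: pochhammer_pos)
      then show "(-1) ^ s * coeff ?p s > 0"
        by (simp add: coeff_jensen_poly flip: power_add mult_2)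
      fix k assume k: "k < s"
      show "0 \<le> z k" using zD(2)[OF k] by simp
      \<comment> \<open>The sign makes \<open>q\<close> positive at \<open>z k\<close>, so that
        \<open>z k\<close> maximizes \<open>q\<close> on \<open>{0..z k}\<close>.\<close>
      define q where "q = smult ((-1) ^ Suc k) ?Q"
      note ext = laguerre_gen_extrema[OF z k]
      have abs_q: "\<bar>poly q u\<bar> = \<bar>poly ?Q u\<bar>" for u by (simp add: q_def abs_mult)
      have qz: "poly q (z k) = \<bar>poly ?Q (z k)\<bar>" using ext(3) abs_q[of "z k"] by (simp add: q_def)
      have "poly q u \<le> poly q (z k)" if "0 \<le> u" "u \<le> z k" for u
        using ext(1)[OF that] abs_q[of u] qz by linarith
      moreover have "poly ?Q 0 = 1" by (simp add: poly_0_coeff_0 coeff_jensen_poly)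
      then have "poly q 0 < poly q (z k)" using ext(2) abs_q[of 0] qz by linarith
      ultimately have "poly (beta_mean b (pderiv q)) (z k) > 0"
        by (rule beta_mean_pderiv_pos[OF b zD(2)[OF k]])
      moreover have "pderiv ?Q = smult (- 2 * real (Suc s)) ?L"
        using pderiv_laguerre_gen[of "1/2" s] by (simp add: mult.commute del: of_nat_Suc)
      then have "pderiv q = smult ((-1) ^ Suc k * (- 2 * real (Suc s))) ?L"
        by (simp add: q_def pderiv_smult pderiv_minus del: of_nat_Suc)
      then have "poly (beta_mean b (pderiv q)) (z k) = 2 * real (Suc s) * ((-1) ^ k * poly ?p (z k))"
        by (simp add: beta_mean_smult p del: of_nat_Suc)
      ultimately show "(-1) ^ k * poly ?p (z k) > 0"
        by (simp add: zero_less_mult_iff del: of_nat_Suc)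
    qed
  qed
qed

section \<open>Parameter shifts and transfer to the hypergeometric polynomial\<close>

text \<open>The factor \<open>(a + m) / a\<close> equals
  \<open>pochhammer (a + 1) m / pochhammer a m\<close>, so a lower parameter \<open>a + 1\<close>
  can be replaced by \<open>a\<close>.\<close>

lemma simple_positive_zeros_jensen_euler:
  fixes a :: real
  assumes "simple_positive_zeros n z (jensen_poly n \<gamma>)" "a > 0"
  shows "\<exists>w. simple_positive_zeros n w (jensen_poly n (\<lambda>m. \<gamma> m * ((a + m) / a)))"
proof -
  let ?p = "jensen_poly n \<gamma>"
  obtain w where w: "simple_positive_zeros n w (smult a ?p + [:0, 1:] * pderiv ?p)"
    using simple_positive_zeros_euler[OF assms] by auto
  have "smult (1 / a) (smult a ?p + [:0, 1:] * pderiv ?p) = jensen_poly n (\<lambda>m. \<gamma> m * ((a + m) / a))"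
  proof (rule poly_eqI)
    fix m show "coeff (smult (1 / a) (smult a ?p + [:0, 1:] * pderiv ?p)) m
      = coeff (jensen_poly n (\<lambda>m. \<gamma> m * ((a + m) / a))) m"
      using assms(2) by (cases m) (simp_all add: coeff_jensen_poly coeff_pderiv field_simps)
  qed
  with simple_positive_zeros_smult[OF w, of "1 / a"] assms(2) show ?thesis by auto
qed

lemma pochhammer_plus1_ratio:
  "a > 0 \<Longrightarrow> pochhammer (a + 1) m = pochhammer a m * ((a + m) / a)" for a :: real
  using pochhammer_rec[of a m] pochhammer_Suc[of a m] by (simp add: field_simps)

lemma map_poly_of_real_mult:
  "map_poly of_real (p * q) = map_poly of_real p * (map_poly of_real q :: complex poly)"
  by (rule poly_eqI) (simp add: coeff_map_poly coeff_mult)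

text \<open>The derivative of a product of distinct linear factors vanishes at none of its zeros, so
  the complex polynomial is square-free.\<close>

lemma simple_positive_zeros_complex:
  assumes "simple_positive_zeros n z p"
    and "poly (map_poly complex_of_real p) w = 0"
  shows "w \<in> \<real> \<and> order w (map_poly of_real p) = 1"
proof -
  obtain c where z: "strict_mono_on {..<n} z" and c: "c > 0" "p = smult c (\<Prod>k<n. [:z k, -1:])"
    using assms unfolding simple_positive_zeros_def by auto
  let ?z = "\<lambda>k. complex_of_real (z k)"
  have "map_poly complex_of_real (\<Prod>k<n. [:z k, -1:]) = (\<Prod>k<n. [:?z k, -1:])"
    by (induction n) (simp_all add: map_poly_of_real_mult map_poly_pCons del: mult_pCons_right)
  then have P: "map_poly complex_of_real p = smult (of_real c) (\<Prod>k<n. [:?z k, -1:])"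
    by (simp add: c map_poly_smult)
  have root: "\<exists>k<n. a = ?z k" if "poly (map_poly complex_of_real p) a = 0" for a
    using that c(1) unfolding P by (auto simp: poly_prod)
  have "inj_on ?z {..<n}"
    using strict_mono_on_imp_inj_on[OF z] by (auto simp: inj_on_def)
  then have "poly (pderiv (map_poly complex_of_real p)) a \<noteq> 0" if "poly (map_poly complex_of_real p) a = 0" for a
    using root[OF that] c(1) unfolding P by (auto simp: pderiv_smult poly_pderiv_prod_linear[where z = ?z] inj_on_def)
  then have "rsquarefree (map_poly complex_of_real p)" unfolding rsquarefree_roots by auto
  moreover have "map_poly complex_of_real p \<noteq> 0"
    using c(1) unfolding P by auto
  ultimately show ?thesis using root[OF assms(2)] rsquarefree_root_order assms(2) by auto
qed

text \<open>The upper parameter \<open>-s\<close> divided by \<open>fact m\<close> yields the signed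
  binomial coefficient of \<open>jensen_poly\<close>.\<close>

lemma hypergeometric_eq_jensen_poly:
  fixes as bs :: "real list"
  shows "hypergeometric (- of_nat s # map of_real as) (map of_real bs) x
    = poly (map_poly of_real
        (jensen_poly s (\<lambda>m. (\<Prod>a\<leftarrow>as. pochhammer a m) / (\<Prod>b\<leftarrow>bs. pochhammer b m)))) x"
proof -
  let ?\<gamma> = "\<lambda>m. (\<Prod>a\<leftarrow>as. pochhammer a m) / (\<Prod>b\<leftarrow>bs. pochhammer b m)"
  have prod: "(\<Prod>a\<leftarrow>map of_real cs. pochhammer a m) = complex_of_real (\<Prod>a\<leftarrow>cs. pochhammer a m)" for cs m
    by (induction cs) (simp_all add: pochhammer_of_real)
  have neg: "pochhammer (- of_nat s) m / fact m = (-1) ^ m * (of_nat (s choose m) :: complex)" for m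
    by (simp add: binomial_gbinomial gbinomial_pochhammer flip: power_add mult_2)
  have "poly (map_poly of_real (jensen_poly s ?\<gamma>)) x
      = (\<Sum>m\<le>s. coeff (map_poly of_real (jensen_poly s ?\<gamma>)) m * x ^ m)"
    by (intro poly_eq_sum_atMost order_trans[OF map_poly_degree_leq degree_jensen_poly_le])
  also have "\<dots> = hypergeometric (- of_nat s # map of_real as) (map of_real bs) x"
    unfolding hypergeometric_terminating[of s "- of_nat s # map of_real as", OF list.set_intros(1)]
  proof (rule sum.cong[OF refl])
    fix m
    have "(\<Prod>a\<leftarrow>- of_nat s # map of_real as. pochhammer a m) / (\<Prod>b\<leftarrow>map of_real bs. pochhammer b m) * (x ^ m / fact m)
      = (pochhammer (- of_nat s) m / fact m) * of_real (?\<gamma> m) * x ^ m"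
      by (simp add: prod del: map_map)
    then show "coeff (map_poly of_real (jensen_poly s ?\<gamma>)) m * x ^ m
      = (\<Prod>a\<leftarrow>- of_nat s # map of_real as. pochhammer a m) / (\<Prod>b\<leftarrow>map of_real bs. pochhammer b m) * (x ^ m / fact m)"
      by (simp only: neg) (simp add: coeff_map_poly coeff_jensen_poly)
  qed
  finally show ?thesis by simp
qed

theorem theorem4:
  fixes s n :: nat and \<nu> :: real
  assumes "(\<nu> \<in> {-1/2..1/2} \<and> n \<in> {0, 1}) \<or> (\<nu> \<in> {0<..1/2} \<and> n = 2)"
  shows "\<exists>p :: complex poly.
    (\<forall>x. poly p x =
       hypergeometric
         [- of_nat s, 1, of_real (\<nu> / 2 + 1), of_real (\<nu> / 2 + 3/2)]
         [3/2, of_real (\<nu> + 3/2),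
          of_real ((\<nu> - real n) / 2 + 1), of_real ((\<nu> - real n) / 2 + 3/2)]
         x) \<and>
    (\<forall>z. poly p z = 0 \<longrightarrow> z \<in> \<real> \<and> order z p = 1)"
proof -
  define \<gamma> where "\<gamma> m = fact m / (pochhammer (3/2) m * pochhammer (\<nu> + 3/2) m)" for m
  define r where "r a m = (a + real m) / a" for a :: real and m
  define P where "P = jensen_poly s (\<lambda>m. (\<Prod>a\<leftarrow>[1, \<nu> / 2 + 1, \<nu> / 2 + 3/2]. pochhammer a m) /
    (\<Prod>b\<leftarrow>[3/2, \<nu> + 3/2, (\<nu> - real n) / 2 + 1, (\<nu> - real n) / 2 + 3/2]. pochhammer b m))"
  have hyp: "poly (map_poly of_real P) x = hypergeometric
         [- of_nat s, 1, of_real (\<nu> / 2 + 1), of_real (\<nu> / 2 + 3/2)]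
         [3/2, of_real (\<nu> + 3/2),
          of_real ((\<nu> - real n) / 2 + 1), of_real ((\<nu> - real n) / 2 + 3/2)] x" for x
    using hypergeometric_eq_jensen_poly[of s "[1, \<nu> / 2 + 1, \<nu> / 2 + 3/2]"
        "[3/2, \<nu> + 3/2, (\<nu> - real n) / 2 + 1, (\<nu> - real n) / 2 + 3/2]" x]
    unfolding P_def by simp
  have pos: "pochhammer (\<nu> / 2 + 1) m > 0" "pochhammer (\<nu> / 2 + 3/2) m > 0" for m
    using assms by (auto intro!: pochhammer_pos)
  \<comment> \<open>The range of \<open>\<nu>\<close> puts \<open>b = \<nu> + 3/2\<close> into
    \<open>{1..2}\<close>.\<close>
  have zeros0: "\<exists>z. simple_positive_zeros s z (jensen_poly s \<gamma>)"
    unfolding \<gamma>_def using assms by (intro simple_positive_zeros_beta_laguerre) auto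
  have \<nu>: "(\<nu> + 1) / 2 > 0" using assms by auto
  have zeros1: "\<exists>z. simple_positive_zeros s z (jensen_poly s (\<lambda>m. \<gamma> m * r ((\<nu> + 1) / 2) m))"
    unfolding r_def using zeros0 simple_positive_zeros_jensen_euler[OF _ \<nu>] by blast
  have ratio1: "pochhammer (\<nu> / 2 + 3/2) m = pochhammer ((\<nu> + 1) / 2) m * r ((\<nu> + 1) / 2) m" for m
  proof -
    have "\<nu> / 2 + 3/2 = (\<nu> + 1) / 2 + 1" by (simp add: field_simps)
    then show ?thesis using pochhammer_plus1_ratio[OF \<nu>] unfolding r_def by simp
  qed
  have pos1: "pochhammer ((\<nu> + 1) / 2) m > 0" for m
    using assms by (auto intro!: pochhammer_pos)
  consider "n = 0" | "n = 1" | "n = 2" "\<nu> > 0" using assms by auto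
  then have "\<exists>z. simple_positive_zeros s z P"
  proof cases
    case 1
    have "P = jensen_poly s \<gamma>" using pos unfolding P_def \<gamma>_def
      by (intro arg_cong[of _ _ "jensen_poly s"] ext) (simp add: \<open>n = 0\<close> less_le flip: pochhammer_fact)
    with zeros0 show ?thesis by simp
  next
    case 2
    have "P = jensen_poly s (\<lambda>m. \<gamma> m * r ((\<nu> + 1) / 2) m)"
      unfolding P_def \<gamma>_def
    proof (intro arg_cong[of _ _ "jensen_poly s"] ext, goal_cases)
      case (1 m)
      \<comment> \<open>The parameter \<open>\<nu> / 2 + 1\<close> occurs above and below and
        cancels, leaving one shift.\<close>
      have e: "(\<nu> - real n) / 2 + 1 = (\<nu> + 1) / 2" "(\<nu> - real n) / 2 + 3/2 = \<nu> / 2 + 1" 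
        using 2 by (simp_all add: field_simps)
      show ?case using pos(1)[of m] pos1[of m]
        by (simp only: list.map prod_list.Cons prod_list.Nil e ratio1) (simp flip: pochhammer_fact)
    qed
    with zeros1 show ?thesis by simp
  next
    case 3
    have ratio2: "pochhammer (\<nu> / 2 + 1) m = pochhammer (\<nu> / 2) m * r (\<nu> / 2) m" for m
      using pochhammer_plus1_ratio[of "\<nu> / 2" m] 3 unfolding r_def by simp
    have pos2: "pochhammer (\<nu> / 2) m > 0" for m using 3 by (auto intro!: pochhammer_pos)
    have "P = jensen_poly s (\<lambda>m. \<gamma> m * r ((\<nu> + 1) / 2) m * r (\<nu> / 2) m)"
      unfolding P_def \<gamma>_def
    proof (intro arg_cong[of _ _ "jensen_poly s"] ext, goal_cases)
      case (1 m)
      \<comment> \<open>Both lower parameters are shifted; the second shift has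
        \<open>a = \<nu> / 2\<close>, whence the condition \<open>\<nu> > 0\<close>.\<close>
      have e: "(\<nu> - real n) / 2 + 1 = \<nu> / 2" "(\<nu> - real n) / 2 + 3/2 = (\<nu> + 1) / 2" 
        using 3 by (simp_all add: field_simps)
      show ?case using pos2[of m] pos1[of m]
        by (simp only: list.map prod_list.Cons prod_list.Nil e ratio1 ratio2) (simp flip: pochhammer_fact)
    qed
    with zeros1 simple_positive_zeros_jensen_euler[of s _ _ "\<nu> / 2"] 3 show ?thesis unfolding r_def by fastforce
  qed
  with hyp show ?thesis by (intro exI[of _ "map_poly of_real P"]) (auto dest: simple_positive_zeros_complex)
qed

end
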